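(* Let $(X,\mathcal{B})$ be an $\mathbf{S}_5$ ball space and let $f:X\to X$ be a function such that $f(B)\in\mathcal{B}$ for every $B\in\mathcal{B}$. 1) If every $f$-closed ball contains an $f$-contracting ball, then $f$ has a fixed point in each $f$-closed ball. 2) If every $f$-closed ball is $f$-contracting, then $f$ has a unique fixed point in each $f$-closed ball. If in addition $X\in\mathcal{B}$, then $f$ has a unique fixed point.
   Context: A ball space $(X,\mathcal{B})$ consists of a nonempty set $X$ and a nonempty family $\mathcal{B}$ of nonempty subsets of $X$, called balls. A nest of balls is a nonempty subset of $\mathcal{B}$ which is totally ordered by inclusion. $(X,\mathcal{B})$ is an $\mathbf{S}_5$ ball space if the intersection of each nest of balls is a ball (in particular nonempty). For a function $f:X\to X$, a subset $S\subseteq X$ is $f$-closed if $f(S)\subseteq S$. An $f$-closed set $S$ is $f$-contracting if $f(S)\subsetneq S$ unless $S$ is a singleton (so every $f$-closed singleton is $f$-contracting). An $f$-closed (respectively $f$-contracting) ball is an element of $\mathcal{B}$ which is an $f$-closed (respectively $f$-contracting) set. *)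

theory Defs
  imports Main
begin

definition ball_space :: "'a set \<Rightarrow> 'a set set \<Rightarrow> bool" where
  "ball_space X \<B> \<longleftrightarrow> X \<noteq> {} \<and> \<B> \<noteq> {} \<and> (\<forall>B\<in>\<B>. B \<noteq> {} \<and> B \<subseteq> X)"

definition nest :: "'a set set \<Rightarrow> 'a set set \<Rightarrow> bool" where
  "nest \<B> \<N> \<longleftrightarrow> \<N> \<noteq> {} \<and> subset.chain \<B> \<N>"

definition S5_ball_space :: "'a set \<Rightarrow> 'a set set \<Rightarrow> bool" where
  "S5_ball_space X \<B> \<longleftrightarrow> ball_space X \<B> \<and> (\<forall>\<N>. nest \<B> \<N> \<longrightarrow> \<Inter>\<N> \<in> \<B>)"

definition f_closed :: "('a \<Rightarrow> 'a) \<Rightarrow> 'a set \<Rightarrow> bool" where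
  "f_closed f S \<longleftrightarrow> f ` S \<subseteq> S"

definition f_contracting :: "('a \<Rightarrow> 'a) \<Rightarrow> 'a set \<Rightarrow> bool" where
  "f_contracting f S \<longleftrightarrow> f_closed f S \<and> (\<not> is_singleton S \<longrightarrow> f ` S \<subset> S)"

end

theory Submission
  imports Defs
begin

text \<open>
  An \<open>f\<close>-closed ball \<open>M\<close> that is minimal among the \<open>f\<close>-closed balls containing a given set \<open>A\<close> of fixed
  points satisfies \<open>f ` M = M\<close>: its image is again an \<open>f\<close>-closed ball, and it still contains \<open>A\<close>
  because \<open>f\<close> does not move the points of \<open>A\<close>. Such minimal balls exist by Zorn's lemma, since the
  \<open>S\<^sub>5\<close> property makes the intersection of a nest of these balls a ball of the same kind. If \<open>M\<close> is
  contracting, then \<open>f ` M = M\<close> forces \<open>M\<close> to be a singleton.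

  Existence of fixed points is the case \<open>A = {}\<close>: a contracting ball inside \<open>M\<close> is \<open>M\<close> itself by
  minimality, so \<open>M = {x}\<close> with \<open>f x = x\<close>. Uniqueness is the case where \<open>A\<close> consists of two fixed
  points: a singleton containing both shows that they agree.
\<close>

lemma f_closed_image: "f_closed f S \<Longrightarrow> f_closed f (f ` S)"
  unfolding f_closed_def by blast

lemma f_closed_Inter: "(\<And>S. S \<in> \<N> \<Longrightarrow> f_closed f S) \<Longrightarrow> f_closed f (\<Inter>\<N>)"
  unfolding f_closed_def by blast

text \<open>
  If \<open>f ` S = S\<close>, then the strict inclusion \<open>f ` S \<subset> S\<close> fails, which leaves only the singleton
  alternative in the definition of a contracting set.
\<close>

lemma f_contracting_surj_singleton:
  assumes "f_contracting f S" and "f ` S = S"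
  obtains x where "S = {x}" and "f x = x"
  using assms unfolding f_contracting_def is_singleton_def by auto

text \<open>
  Zorn's lemma for reverse inclusion. The bounds from below \<open>A\<close> and from above \<open>B\<close> both survive
  intersections of nests, so each of these intervals of \<open>f\<close>-closed balls is inductive.
\<close>

lemma minimal_f_closed_ball:
  assumes S5: "S5_ball_space X \<B>"
    and B: "B \<in> \<B>" "f_closed f B" "A \<subseteq> B"
  obtains M where "M \<in> \<B>" "f_closed f M" "A \<subseteq> M" "M \<subseteq> B"
    and "\<And>C. C \<in> \<B> \<Longrightarrow> f_closed f C \<Longrightarrow> A \<subseteq> C \<Longrightarrow> C \<subseteq> M \<Longrightarrow> C = M"
proof -
  define \<F> where "\<F> = {C \<in> \<B>. f_closed f C \<and> A \<subseteq> C \<and> C \<subseteq> B}"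
  have "\<exists>M\<in>\<F>. \<forall>C\<in>\<F>. M \<supseteq> C \<longrightarrow> C = M"
  proof (rule predicate_Zorn)
    show "partial_order_on \<F> (relation_of (\<supseteq>) \<F>)"
      by (rule partial_order_on_relation_ofI) auto
  next
    fix \<N>
    assume "\<N> \<in> Chains (relation_of (\<supseteq>) \<F>)"
    then have sub: "\<N> \<subseteq> \<F>" and lin: "\<forall>C\<in>\<N>. \<forall>D\<in>\<N>. C \<subseteq> D \<or> D \<subseteq> C"
      unfolding Chains_def relation_of_def by auto
    show "\<exists>L\<in>\<F>. \<forall>C\<in>\<N>. C \<supseteq> L"
    proof (cases "\<N> = {}")
      \<comment> \<open>The empty chain is not a nest; \<open>B\<close> itself bounds it.\<close>
      case True
      then show ?thesis using B unfolding \<F>_def by auto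
    next
      case False
      have "nest \<B> \<N>"
        using False sub lin unfolding nest_def subset_chain_def \<F>_def by auto
      then have "\<Inter>\<N> \<in> \<B>"
        using S5 unfolding S5_ball_space_def by blast
      moreover have "f_closed f (\<Inter>\<N>)"
        using sub unfolding \<F>_def by (blast intro: f_closed_Inter)
      ultimately have "\<Inter>\<N> \<in> \<F>"
        using False sub unfolding \<F>_def by blast
      then show ?thesis by blast
    qed
  qed
  then obtain M where M: "M \<in> \<F>" and min: "\<And>C. C \<in> \<F> \<Longrightarrow> C \<subseteq> M \<Longrightarrow> C = M"
    by blast
  show thesis
  proof (rule that)
    show "M \<in> \<B>" "f_closed f M" "A \<subseteq> M" "M \<subseteq> B"
      using M unfolding \<F>_def by auto
  next
    fix C
    assume "C \<in> \<B>" "f_closed f C" "A \<subseteq> C" "C \<subseteq> M"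
    with M have "C \<in> \<F>" unfolding \<F>_def by auto
    then show "C = M" using \<open>C \<subseteq> M\<close> by (rule min)
  qed
qed

text \<open>
  Points of \<open>A\<close> stay in the image because they are fixed; hence the image of a minimal ball
  competes with that ball and must equal it.
\<close>

lemma minimal_f_closed_ball_surj:
  assumes S5: "S5_ball_space X \<B>"
    and image: "\<And>B. B \<in> \<B> \<Longrightarrow> f ` B \<in> \<B>"
    and B: "B \<in> \<B>" "f_closed f B" "A \<subseteq> B"
    and fixed: "\<And>x. x \<in> A \<Longrightarrow> f x = x"
  obtains M where "M \<in> \<B>" "f_closed f M" "A \<subseteq> M" "M \<subseteq> B" "f ` M = M"
    and "\<And>C. C \<in> \<B> \<Longrightarrow> f_closed f C \<Longrightarrow> A \<subseteq> C \<Longrightarrow> C \<subseteq> M \<Longrightarrow> C = M"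
proof -
  obtain M where M: "M \<in> \<B>" "f_closed f M" "A \<subseteq> M" "M \<subseteq> B"
    and min: "\<And>C. C \<in> \<B> \<Longrightarrow> f_closed f C \<Longrightarrow> A \<subseteq> C \<Longrightarrow> C \<subseteq> M \<Longrightarrow> C = M"
    by (rule minimal_f_closed_ball[OF S5 B]) (rule that)
  have "A \<subseteq> f ` M"
    using M(3) fixed by force
  moreover have "f ` M \<subseteq> M"
    using M(2) unfolding f_closed_def .
  ultimately have surj: "f ` M = M"
    using min image[OF M(1)] f_closed_image[OF M(2)] by blast
  show thesis using M surj min by (rule that)
qed

lemma fixed_point_in_f_closed_ball:
  assumes S5: "S5_ball_space X \<B>"
    and image: "\<And>B. B \<in> \<B> \<Longrightarrow> f ` B \<in> \<B>"
    and contr: "\<And>B. B \<in> \<B> \<Longrightarrow> f_closed f B \<Longrightarrow> \<exists>C\<in>\<B>. C \<subseteq> B \<and> f_contracting f C"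
    and B: "B \<in> \<B>" "f_closed f B"
  shows "\<exists>x\<in>B. f x = x"
proof -
  obtain M where M: "M \<in> \<B>" "f_closed f M" "M \<subseteq> B" "f ` M = M"
    and min: "\<And>C. C \<in> \<B> \<Longrightarrow> f_closed f C \<Longrightarrow> C \<subseteq> M \<Longrightarrow> C = M"
  proof (rule minimal_f_closed_ball_surj[OF S5 image B, of "{}"])
    fix M
    assume "M \<in> \<B>" "f_closed f M" "M \<subseteq> B" "f ` M = M"
      and "\<And>C. C \<in> \<B> \<Longrightarrow> f_closed f C \<Longrightarrow> {} \<subseteq> C \<Longrightarrow> C \<subseteq> M \<Longrightarrow> C = M"
    then show thesis by (intro that) simp_all
  qed simp_all
  obtain C where C: "C \<in> \<B>" "C \<subseteq> M" "f_contracting f C"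
    using contr[OF M(1,2)] by blast
  then have "C = M"
    using min unfolding f_contracting_def by blast
  with C(3) have "f_contracting f M" by simp
  then obtain x where "M = {x}" "f x = x"
    using M(4) by (rule f_contracting_surj_singleton)
  with M(3) show ?thesis by blast
qed

lemma fixed_points_in_f_closed_ball_eq:
  assumes S5: "S5_ball_space X \<B>"
    and image: "\<And>B. B \<in> \<B> \<Longrightarrow> f ` B \<in> \<B>"
    and contr: "\<And>B. B \<in> \<B> \<Longrightarrow> f_closed f B \<Longrightarrow> f_contracting f B"
    and B: "B \<in> \<B>" "f_closed f B"
    and x: "x \<in> B" "f x = x" and y: "y \<in> B" "f y = y"
  shows "x = y"
proof -
  have sub: "{x, y} \<subseteq> B" and fixed: "\<And>z. z \<in> {x, y} \<Longrightarrow> f z = z"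
    using x y by auto
  obtain M where M: "M \<in> \<B>" "f_closed f M" "{x, y} \<subseteq> M" "f ` M = M"
    by (rule minimal_f_closed_ball_surj[OF S5 image B sub fixed]) (assumption | rule that)+
  obtain z where "M = {z}"
    using contr[OF M(1,2)] M(4) by (rule f_contracting_surj_singleton)
  with M(3) show ?thesis by blast
qed

theorem theorem2p2:
  fixes X :: "'a set" and \<B> :: "'a set set" and f :: "'a \<Rightarrow> 'a"
  assumes "S5_ball_space X \<B>"
    and "f ` X \<subseteq> X"
    and "\<And>B. B \<in> \<B> \<Longrightarrow> f ` B \<in> \<B>"
  shows "((\<forall>B\<in>\<B>. f_closed f B \<longrightarrow> (\<exists>C\<in>\<B>. C \<subseteq> B \<and> f_contracting f C)) \<longrightarrow>
            (\<forall>B\<in>\<B>. f_closed f B \<longrightarrow> (\<exists>x\<in>B. f x = x)))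
       \<and> ((\<forall>B\<in>\<B>. f_closed f B \<longrightarrow> f_contracting f B) \<longrightarrow>
            (\<forall>B\<in>\<B>. f_closed f B \<longrightarrow> (\<exists>!x. x \<in> B \<and> f x = x)) \<and>
            (X \<in> \<B> \<longrightarrow> (\<exists>!x. x \<in> X \<and> f x = x)))"
proof -
  have existence: "\<exists>x\<in>B. f x = x"
    if "\<forall>B\<in>\<B>. f_closed f B \<longrightarrow> (\<exists>C\<in>\<B>. C \<subseteq> B \<and> f_contracting f C)" "B \<in> \<B>" "f_closed f B" for B
    using fixed_point_in_f_closed_ball[OF assms(1,3)] that by blast
  have unique: "\<exists>!x. x \<in> B \<and> f x = x"
    if contr: "\<forall>B\<in>\<B>. f_closed f B \<longrightarrow> f_contracting f B" and B: "B \<in> \<B>" "f_closed f B" for B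
  proof -
    have "\<exists>x\<in>B. f x = x"
      using existence[OF _ B] contr by blast
    moreover have "x = y" if "x \<in> B" "f x = x" "y \<in> B" "f y = y" for x y
      using fixed_points_in_f_closed_ball_eq[OF assms(1,3) _ B that] contr by blast
    ultimately show ?thesis by blast
  qed
  have "f_closed f X"
    using assms(2) unfolding f_closed_def .
  with existence unique show ?thesis by blast
qed

end
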